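(* Let $G=(V,E)$ be an undirected graph with edge weights $w:E\to\mathbb{R}_{\geqslant 0}$, let $T\subseteq V$ be a set of $k$ terminals, let $\widehat{X}\subseteq E$ be a prediction and $\alpha\geqslant 1$. Run the following algorithm: set $w_\alpha(e)=w(e)/\alpha$ for $e\in\widehat{X}$ and $w_\alpha(e)=w(e)$ otherwise; compute a minimum spanning tree $\mathrm{MST}_\alpha$ of the complete graph on $T$ in which each pair $\{t_1,t_2\}$ has cost equal to the $w_\alpha$-shortest-path distance between $t_1$ and $t_2$ in $G$; output $X$, the union over edges $\{t_1,t_2\}$ of $\mathrm{MST}_\alpha$ of a $w_\alpha$-cheapest path in $G$ from $t_1$ to $t_2$. Let $X'\subseteq E$ be any Steiner tree for $T$ in $G$, let $(\eta^+,\eta^-)=(w(\widehat{X}\setminus X'), w(X'\setminus\widehat{X}))$, let $\mathrm{MST}$ be a minimum spanning tree of the complete graph on $T$ with costs $\mathbf{c}(\{t_1,t_2\})$ equal to the $w$-shortest-path distance between $t_1$ and $t_2$ in $G$, and let $S$ be a set of $\min\{k-1, |\widehat{X}\setminus X'|\}$ edges of $\mathrm{MST}$ of highest cost $\mathbf{c}$. Then $X$ is a Steiner tree (its edges connect all terminals) and \[ w(X)\leqslant \left(1+\frac1\alpha\right)w(X') + \left(1-\frac1\alpha\right)\eta^- + \min\Big\{\eta^+,\ (\alpha-1)\sum_{e\in S}\mathbf{c}(e)\Big\}. \]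
   Context: A Steiner tree for terminal set $T$ in $G$ is a set of edges $X\subseteq E$ such that all terminals lie in the same connected component of $(V,X)$. The bound holds for any choices of minimum spanning trees and cheapest paths (ties broken arbitrarily). $G$ is assumed connected on the terminals. *)

theory Defs
  imports Complex_Main
begin

text \<open>
  A finite simple undirected graph is a pair of a vertex set \<open>V\<close> and an edge set \<open>E\<close>,
  edges being two-element subsets of \<open>V\<close>. Paths are nonempty lists of distinct vertices.
\<close>

definition complete_edges :: "'a set \<Rightarrow> 'a set set" where
  "complete_edges V = {e. e \<subseteq> V \<and> card e = 2}"

definition ugraph :: "'a set \<Rightarrow> 'a set set \<Rightarrow> bool" where
  "ugraph V E \<longleftrightarrow> finite V \<and> E \<subseteq> complete_edges V"

fun path_edges :: "'a list \<Rightarrow> 'a set list" where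
  "path_edges (u # v # p) = {u, v} # path_edges (v # p)"
| "path_edges p = []"

definition is_path :: "'a set \<Rightarrow> 'a set set \<Rightarrow> 'a list \<Rightarrow> bool" where
  "is_path V E p \<longleftrightarrow> p \<noteq> [] \<and> distinct p \<and> set p \<subseteq> V \<and> set (path_edges p) \<subseteq> E"

definition component :: "'a set \<Rightarrow> 'a set set \<Rightarrow> 'a \<Rightarrow> 'a set" where
  "component V E u = {v. \<exists>p. is_path V E p \<and> hd p = u \<and> last p = v}"

definition in_one_component :: "'a set \<Rightarrow> 'a set set \<Rightarrow> 'a set \<Rightarrow> bool" where
  "in_one_component V E T \<longleftrightarrow> (\<forall>s\<in>T. \<forall>t\<in>T. t \<in> component V E s)"

definition steiner_tree :: "'a set \<Rightarrow> 'a set set \<Rightarrow> 'a set \<Rightarrow> 'a set set \<Rightarrow> bool" where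
  "steiner_tree V E T X \<longleftrightarrow> X \<subseteq> E \<and> in_one_component V X T"

definition is_cycle :: "'a set \<Rightarrow> 'a set set \<Rightarrow> 'a list \<Rightarrow> bool" where
  "is_cycle V E p \<longleftrightarrow> is_path V E p \<and> 3 \<le> length p \<and> {last p, hd p} \<in> E"

definition spanning_tree :: "'a set \<Rightarrow> 'a set set \<Rightarrow> 'a set set \<Rightarrow> bool" where
  "spanning_tree V E F \<longleftrightarrow> F \<subseteq> E \<and> in_one_component V F V \<and> (\<nexists>p. is_cycle V F p)"

definition minimum_spanning_tree ::
  "'a set \<Rightarrow> 'a set set \<Rightarrow> ('a set \<Rightarrow> real) \<Rightarrow> 'a set set \<Rightarrow> bool" where
  "minimum_spanning_tree V E c F \<longleftrightarrow>
     spanning_tree V E F \<and> (\<forall>F'. spanning_tree V E F' \<longrightarrow> sum c F \<le> sum c F')"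

definition path_cost :: "('a set \<Rightarrow> real) \<Rightarrow> 'a list \<Rightarrow> real" where
  "path_cost w p = sum_list (map w (path_edges p))"

text \<open>Here \<open>e = {s, t}\<close> is an unordered pair; a path between \<open>s\<close> and \<open>t\<close> may be listed
  starting from either end.\<close>

definition paths_between :: "'a set \<Rightarrow> 'a set set \<Rightarrow> 'a set \<Rightarrow> 'a list set" where
  "paths_between V E e = {p. is_path V E p \<and> {hd p, last p} = e}"

text \<open>Meaningful only if a path exists, since otherwise \<open>Min\<close> is applied to the empty set;
  there are only finitely many paths in a finite graph.\<close>

definition pair_dist :: "'a set \<Rightarrow> 'a set set \<Rightarrow> ('a set \<Rightarrow> real) \<Rightarrow> 'a set \<Rightarrow> real" where
  "pair_dist V E w e = Min (path_cost w ` paths_between V E e)"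

definition cheapest_path ::
  "'a set \<Rightarrow> 'a set set \<Rightarrow> ('a set \<Rightarrow> real) \<Rightarrow> 'a set \<Rightarrow> 'a list \<Rightarrow> bool" where
  "cheapest_path V E w e p \<longleftrightarrow>
     p \<in> paths_between V E e \<and> (\<forall>q\<in>paths_between V E e. path_cost w p \<le> path_cost w q)"

definition terminal_mst ::
  "'a set \<Rightarrow> 'a set set \<Rightarrow> ('a set \<Rightarrow> real) \<Rightarrow> 'a set \<Rightarrow> 'a set set \<Rightarrow> bool" where
  "terminal_mst V E w T M \<longleftrightarrow> minimum_spanning_tree T (complete_edges T) (pair_dist V E w) M"

definition scaled_weight ::
  "('a set \<Rightarrow> real) \<Rightarrow> 'a set set \<Rightarrow> real \<Rightarrow> 'a set \<Rightarrow> real" where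
  "scaled_weight w Xhat \<alpha> e = (if e \<in> Xhat then w e / \<alpha> else w e)"

text \<open>A relation rather than a function: \<open>X\<close> is a possible output for some way of breaking
  ties in the choice of the minimum spanning tree \<open>M\<close> and of the cheapest paths \<open>P e\<close>.\<close>

definition algorithm_output ::
  "'a set \<Rightarrow> 'a set set \<Rightarrow> ('a set \<Rightarrow> real) \<Rightarrow> 'a set \<Rightarrow> 'a set set \<Rightarrow> real \<Rightarrow> 'a set set \<Rightarrow> bool"
where
  "algorithm_output V E w T Xhat \<alpha> X \<longleftrightarrow>
     (\<exists>M P. terminal_mst V E (scaled_weight w Xhat \<alpha>) T M
          \<and> (\<forall>e\<in>M. cheapest_path V E (scaled_weight w Xhat \<alpha>) e (P e))
          \<and> X = (\<Union>e\<in>M. set (path_edges (P e))))"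

definition highest_cost_subset :: "('b \<Rightarrow> real) \<Rightarrow> 'b set \<Rightarrow> nat \<Rightarrow> 'b set \<Rightarrow> bool" where
  "highest_cost_subset c M m S \<longleftrightarrow>
     S \<subseteq> M \<and> card S = m \<and> (\<forall>e\<in>S. \<forall>f\<in>M - S. c f \<le> c e)"

end

theory Submission
  imports Defs
begin

text \<open>
  Write \<open>w\<^sub>\<alpha>\<close> for the scaled weights, so that
  \<open>w(X) = w\<^sub>\<alpha>(X) + (1 - 1/\<alpha>) w(X \<inter> Xhat)\<close>.  The first summand is at most the cost of the
  terminal spanning tree, hence at most \<open>2 w\<^sub>\<alpha>(X')\<close> by shortcutting a tour that traverses every
  edge of \<open>X'\<close> at most twice.  The second is governed by \<open>w(X' \<inter> Xhat) + w(Z)\<close> where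
  \<open>Z = X \<inter> (Xhat - X')\<close>, and \<open>w(Z) \<le> \<eta>\<^sup>+\<close>.  For the other bound, charge every edge of \<open>Z\<close> to a
  tree edge whose cheapest path uses it: \<open>w\<^sub>\<alpha>(Z)\<close> is at most the cost of
  \<open>min (k - 1) |Xhat - X'|\<close> edges of the \<open>w\<^sub>\<alpha>\<close>-tree.  This is at most the cost of the most
  expensive edges of the \<open>w\<close>-tree, because a minimum spanning tree stays minimal under every
  monotone transformation of the costs, in particular under \<open>y \<mapsto> max 0 (y - x)\<close>.
\<close>

subsection \<open>Paths and connectivity\<close>

lemma path_edges_append:
  "path_edges (xs @ y # zs) = path_edges (xs @ [y]) @ path_edges (y # zs)"
proof (induction xs)
  case (Cons x xs)
  then show ?case by (cases xs) auto
qed simp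

lemma path_edges_append2:
  "p \<noteq> [] \<Longrightarrow> q \<noteq> [] \<Longrightarrow> path_edges (p @ q) = path_edges p @ {last p, hd q} # path_edges q"
proof (induction p rule: path_edges.induct)
  case ("2_2" v)
  then show ?case by (cases q) auto
qed auto

lemma path_edges_rev: "path_edges (rev p) = rev (path_edges p)"
proof (induction p rule: path_edges.induct)
  case (1 u v p)
  have "path_edges (rev (u # v # p)) = path_edges (rev p @ v # [u])" by simp
  also have "\<dots> = path_edges (rev p @ [v]) @ path_edges [v, u]" by (rule path_edges_append)
  also have "\<dots> = rev (path_edges (u # v # p))" using 1 by (simp add: insert_commute)
  finally show ?case .
qed auto

lemma path_edges_subset: "e \<in> set (path_edges p) \<Longrightarrow> e \<subseteq> set p"
  by (induction p rule: path_edges.induct) auto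

lemma path_cost_rev: "path_cost w (rev p) = path_cost w p"
  by (simp add: path_cost_def path_edges_rev rev_map[symmetric])

lemma path_cost_nonneg: "\<forall>e\<in>set (path_edges p). 0 \<le> w e \<Longrightarrow> 0 \<le> path_cost w p"
  unfolding path_cost_def by (rule sum_list_nonneg) auto

text \<open>Cut out the closed segment between two occurrences of a repeated vertex and induct on
  the length. The cost claim quantifies over \<open>w\<close> inside the \<open>obtains\<close>, so
  one \<open>q\<close> serves all weights that are nonnegative on the walk.\<close>

lemma walk_contains_path:
  assumes "p \<noteq> []"
  obtains q where "q \<noteq> []" "distinct q" "hd q = hd p" "last q = last p" "set q \<subseteq> set p"
    "set (path_edges q) \<subseteq> set (path_edges p)"
    "\<And>w. (\<forall>e\<in>set (path_edges p). 0 \<le> w e) \<Longrightarrow> path_cost w q \<le> path_cost w p"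
  using assms
proof (induction "length p" arbitrary: p thesis rule: less_induct)
  case less
  show ?case
  proof (cases "distinct p")
    case True
    then show ?thesis using less.prems by (intro less.prems(1)[of p]) auto
  next
    case False
    then obtain xs ys zs y where p: "p = xs @ [y] @ ys @ [y] @ zs"
      using not_distinct_decomp by blast
    define r where "r = xs @ y # zs"
    have e1: "path_edges p = path_edges (xs @ [y]) @ path_edges (y # ys @ [y]) @ path_edges (y # zs)"
      unfolding p using path_edges_append[of xs y "ys @ y # zs"] path_edges_append[of "y # ys" y zs]
      by simp
    have e2: "path_edges r = path_edges (xs @ [y]) @ path_edges (y # zs)"
      unfolding r_def by (rule path_edges_append)
    have hdr: "hd r = hd p" unfolding r_def p by (cases xs) auto
    have lastr: "last r = last p" unfolding r_def p by auto
    have "length r < length p" "r \<noteq> []" unfolding r_def p by auto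
    then obtain q where q: "q \<noteq> []" "distinct q" "hd q = hd r" "last q = last r" "set q \<subseteq> set r"
      "set (path_edges q) \<subseteq> set (path_edges r)"
      "\<And>w. (\<forall>e\<in>set (path_edges r). 0 \<le> w e) \<Longrightarrow> path_cost w q \<le> path_cost w r"
      using less.hyps by blast
    show ?thesis
    proof (rule less.prems(1)[of q])
      show "q \<noteq> []" "distinct q" by (fact q)+
      show "hd q = hd p" "last q = last p" using q hdr lastr by auto
      show "set q \<subseteq> set p" using q(5) unfolding r_def p by auto
      show "set (path_edges q) \<subseteq> set (path_edges p)" using q(6) e1 e2 by auto
      fix w :: "'a set \<Rightarrow> real" assume w: "\<forall>e\<in>set (path_edges p). 0 \<le> w e"
      have "path_cost w q \<le> path_cost w r" using q(7) w e1 e2 by auto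
      also have "\<dots> \<le> path_cost w r + path_cost w (y # ys @ [y])"
        using path_cost_nonneg[of "y # ys @ [y]" w] w e1 by auto
      also have "\<dots> = path_cost w p" unfolding path_cost_def e1 e2 by simp
      finally show "path_cost w q \<le> path_cost w p" .
    qed
  qed
qed

text \<open>Connectivity is handled through the closure \<open>(adj F)\<^sup>*\<close>, which
  composes freely, instead of through lists of distinct vertices, whose concatenations may repeat
  vertices.\<close>

definition adj :: "'a set set \<Rightarrow> ('a \<times> 'a) set" where
  "adj F = {(x, y). {x, y} \<in> F}"

lemma adj_iff [simp]: "(x, y) \<in> adj F \<longleftrightarrow> {x, y} \<in> F"
  by (simp add: adj_def)

lemma adj_rtrancl_sym: "(x, y) \<in> (adj F)\<^sup>* \<Longrightarrow> (y, x) \<in> (adj F)\<^sup>*"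
  by (rule symD[OF sym_rtrancl]) (auto simp: sym_def insert_commute)

lemma adj_rtrancl_mono: "F \<subseteq> G \<Longrightarrow> (x, y) \<in> (adj F)\<^sup>* \<Longrightarrow> (x, y) \<in> (adj G)\<^sup>*"
  by (rule rtrancl_mono[THEN subsetD]) auto

lemma adj_rtrancl_subst:
  assumes "\<And>x y. {x, y} \<in> F \<Longrightarrow> (x, y) \<in> (adj G)\<^sup>*" "(a, b) \<in> (adj F)\<^sup>*"
  shows "(a, b) \<in> (adj G)\<^sup>*"
  using assms(2) by (induction rule: rtrancl_induct) (auto intro: rtrancl_trans assms(1))

lemma walk_connects:
  "p \<noteq> [] \<Longrightarrow> set (path_edges p) \<subseteq> F \<Longrightarrow> (hd p, last p) \<in> (adj F)\<^sup>*"
proof (induction p rule: path_edges.induct)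
  case (1 u v p)
  then have "(u, v) \<in> adj F" "(v, last (v # p)) \<in> (adj F)\<^sup>*" by auto
  then show ?case by (auto intro: converse_rtrancl_into_rtrancl)
qed auto

text \<open>The bridge from explicit paths to closures: reachability yields a walk inside
  \<open>V\<close>, which \<open>walk_contains_path\<close> shortens to a path.\<close>

lemma component_iff:
  assumes F: "F \<subseteq> complete_edges V" and u: "u \<in> V"
  shows "v \<in> component V F u \<longleftrightarrow> (u, v) \<in> (adj F)\<^sup>*"
proof
  assume "v \<in> component V F u"
  then show "(u, v) \<in> (adj F)\<^sup>*"
    using walk_connects unfolding component_def is_path_def by blast
next
  assume "(u, v) \<in> (adj F)\<^sup>*"
  then have "\<exists>p. p \<noteq> [] \<and> set p \<subseteq> V \<and> set (path_edges p) \<subseteq> F \<and> hd p = u \<and> last p = v"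
  proof (induction rule: rtrancl_induct)
    case base
    show ?case using u by (intro exI[of _ "[u]"]) auto
  next
    case (step y z)
    then obtain p where p: "p \<noteq> []" "set p \<subseteq> V" "set (path_edges p) \<subseteq> F" "hd p = u" "last p = y"
      by blast
    have "{y, z} \<in> F" using step by simp
    moreover from this have "z \<in> V" using F unfolding complete_edges_def by auto
    ultimately show ?case using p
      by (intro exI[of _ "p @ [z]"]) (auto simp: path_edges_append2)
  qed
  then obtain p where p: "p \<noteq> []" "set p \<subseteq> V" "set (path_edges p) \<subseteq> F" "hd p = u" "last p = v"
    by blast
  show "v \<in> component V F u"
    using walk_contains_path[OF p(1)] p unfolding component_def is_path_def
    by (smt (verit, best) mem_Collect_eq subset_trans)
qed

lemma in_one_component_iff:
  assumes "F \<subseteq> complete_edges V" "T \<subseteq> V"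
  shows "in_one_component V F T \<longleftrightarrow> (\<forall>s\<in>T. \<forall>t\<in>T. (s, t) \<in> (adj F)\<^sup>*)"
  using assms component_iff[OF assms(1)] unfolding in_one_component_def by blast

subsection \<open>Minimum spanning trees\<close>

lemma complete_edgesE:
  assumes "e \<in> complete_edges V"
  obtains x y where "e = {x, y}" "x \<in> V" "y \<in> V" "x \<noteq> y"
  using assms unfolding complete_edges_def by (auto simp: card_2_iff)

lemma finite_complete_edges: "finite V \<Longrightarrow> finite (complete_edges V)"
  unfolding complete_edges_def by (rule finite_subset[of _ "Pow V"]) auto

text \<open>The rest of the cycle joins the ends of the closing edge the other way round.\<close>

lemma cycle_edge_redundant:
  assumes F: "F \<subseteq> complete_edges V" and cyc: "is_cycle V F p"
  shows "(last p, hd p) \<in> (adj (F - {{last p, hd p}}))\<^sup>*"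
proof -
  have p: "p \<noteq> []" "distinct p" "set p \<subseteq> V" "set (path_edges p) \<subseteq> F" "3 \<le> length p"
    using cyc unfolding is_cycle_def is_path_def by auto
  obtain a b c r where abc: "p = a # b # c # r"
    using p(5) by (auto simp: numeral_3_eq_3 Suc_le_length_iff)
  \<comment> \<open>Here the length of at least 3 matters: by distinctness only the first path edge
    \<open>{a, b}\<close> contains \<open>hd p\<close>, while \<open>last p\<close> lies beyond
    \<open>b\<close>.\<close>
  have "{last p, hd p} \<notin> set (path_edges p)"
  proof
    assume "{last p, hd p} \<in> set (path_edges p)"
    moreover have "path_edges p = {a, b} # path_edges (b # c # r)" using abc by simp
    ultimately consider "{last p, hd p} \<in> set (path_edges (b # c # r))" | "{last p, hd p} = {a, b}"
      by (metis set_ConsD)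
    then show False
    proof cases
      case 1
      then have "hd p \<in> set (b # c # r)" using path_edges_subset by blast
      then show False using p(2) abc by simp
    next
      case 2
      then have "last p \<in> {a, b}" by blast
      moreover have "last p \<in> set (c # r)" unfolding abc by simp
      ultimately show False using p(2) abc by auto
    qed
  qed
  then have "(hd p, last p) \<in> (adj (F - {{last p, hd p}}))\<^sup>*"
    using p by (intro walk_connects) auto
  then show ?thesis by (rule adj_rtrancl_sym)
qed

text \<open>Each use of the edge \<open>{a, b}\<close> is replaced by a detour within
  \<open>G\<close>. This covers the deletion of an edge as well as its exchange for another
  one.\<close>

lemma adj_rtrancl_exchange:
  assumes ab: "(a, b) \<in> (adj G)\<^sup>*" and G: "F - {{a, b}} \<subseteq> G" and st: "(s, t) \<in> (adj F)\<^sup>*"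
  shows "(s, t) \<in> (adj G)\<^sup>*"
proof (rule adj_rtrancl_subst[OF _ st])
  fix x y assume xy: "{x, y} \<in> F"
  show "(x, y) \<in> (adj G)\<^sup>*"
  proof (cases "{x, y} = {a, b}")
    case True
    then have "x = a \<and> y = b \<or> x = b \<and> y = a" by (simp add: doubleton_eq_iff)
    then show ?thesis using ab adj_rtrancl_sym[OF ab] by auto
  next
    case False
    then show ?thesis using xy G by (intro r_into_rtrancl) auto
  qed
qed

text \<open>An inclusion-minimal connecting subset of \<open>N\<close> is acyclic, since an edge of
  a cycle could be deleted without disconnecting anything.\<close>

lemma connecting_contains_spanning_tree:
  assumes T: "finite T" and N: "N \<subseteq> complete_edges T" "in_one_component T N T"
  obtains F where "F \<subseteq> N" "spanning_tree T (complete_edges T) F"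
proof -
  have "finite N" using finite_subset[OF N(1)] finite_complete_edges[OF T] by blast
  define \<F> where "\<F> = {F. F \<subseteq> N \<and> in_one_component T F T}"
  have "finite \<F>" unfolding \<F>_def using \<open>finite N\<close> by (auto intro: finite_subset[of _ "Pow N"])
  moreover have "\<F> \<noteq> {}" using N(2) unfolding \<F>_def by auto
  ultimately have "\<exists>F\<in>\<F>. \<forall>G\<in>\<F>. G \<subseteq> F \<longrightarrow> F = G" by (rule finite_has_minimal)
  then obtain F where F: "F \<subseteq> N" "in_one_component T F T"
    and min: "\<And>G. G \<subseteq> N \<Longrightarrow> in_one_component T G T \<Longrightarrow> G \<subseteq> F \<Longrightarrow> F = G"
    unfolding \<F>_def by auto
  have FT: "F \<subseteq> complete_edges T" using F N by auto
  have "\<not> is_cycle T F p" for p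
  proof
    assume cyc: "is_cycle T F p"
    define e where "e = {last p, hd p}"
    have "in_one_component T (F - {e}) T"
      using F(2) FT adj_rtrancl_exchange[OF cycle_edge_redundant[OF FT cyc] order.refl]
      by (subst in_one_component_iff) (auto simp: in_one_component_iff e_def)
    then have "F = F - {e}" using min[of "F - {e}"] F by auto
    moreover have "e \<in> F" using cyc unfolding is_cycle_def e_def by auto
    ultimately show False by auto
  qed
  then have "spanning_tree T (complete_edges T) F"
    unfolding spanning_tree_def using FT F by auto
  then show ?thesis using that F by blast
qed

lemma minimum_spanning_tree_le_connecting:
  assumes T: "finite T" and M: "minimum_spanning_tree T (complete_edges T) c M"
    and c: "\<forall>e\<in>complete_edges T. 0 \<le> c e"
    and N: "N \<subseteq> complete_edges T" "in_one_component T N T"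
  shows "sum c M \<le> sum c N"
proof -
  obtain F where F: "F \<subseteq> N" "spanning_tree T (complete_edges T) F"
    using connecting_contains_spanning_tree[OF T N] .
  have "sum c M \<le> sum c F" using M F unfolding minimum_spanning_tree_def by auto
  also have "\<dots> \<le> sum c N"
    using F N c finite_subset[OF N(1) finite_complete_edges[OF T]] by (intro sum_mono2) auto
  finally show ?thesis .
qed

text \<open>A path avoiding the edge would close up with it to a cycle.\<close>

lemma spanning_tree_edge_essential:
  assumes M: "spanning_tree T (complete_edges T) M" and e: "{u, v} \<in> M"
  shows "(u, v) \<notin> (adj (M - {{u, v}}))\<^sup>*"
proof
  assume r: "(u, v) \<in> (adj (M - {{u, v}}))\<^sup>*"
  have MT: "M \<subseteq> complete_edges T" using M unfolding spanning_tree_def by auto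
  have uv: "u \<in> T" "v \<in> T" "u \<noteq> v"
    using e MT unfolding complete_edges_def by auto
  have "v \<in> component T (M - {{u, v}}) u"
    using r uv MT by (subst component_iff) auto
  then obtain p where p: "is_path T (M - {{u, v}}) p" "hd p = u" "last p = v"
    unfolding component_def by auto
  \<comment> \<open>One vertex is excluded by \<open>u\<close> and \<open>v\<close> being distinct,
    two vertices because the path would then use the removed edge.\<close>
  have "3 \<le> length p"
  proof (rule ccontr)
    assume "\<not> 3 \<le> length p"
    moreover have "p \<noteq> []" using p unfolding is_path_def by auto
    ultimately have "(\<exists>x. p = [x]) \<or> (\<exists>x y. p = [x, y])"
      by (cases p; cases "tl p"; auto simp: Suc_le_eq)
    then show False using p uv unfolding is_path_def by auto
  qed
  moreover have "is_path T M p" using p unfolding is_path_def by auto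
  ultimately have "is_cycle T M p"
    using p e unfolding is_cycle_def by (auto simp: insert_commute)
  then show False using M unfolding spanning_tree_def by auto
qed

lemma list_crossing:
  assumes "p \<noteq> []" "hd p \<in> A" "last p \<notin> A"
  obtains q r where "p = q @ r" "q \<noteq> []" "r \<noteq> []" "last q \<in> A" "hd r \<notin> A"
  using assms
proof (induction p arbitrary: thesis)
  case (Cons x p)
  then have "p \<noteq> []" by auto
  show ?case
  proof (cases "hd p \<in> A")
    case True
    then obtain q r where "p = q @ r" "q \<noteq> []" "r \<noteq> []" "last q \<in> A" "hd r \<notin> A"
      using Cons.IH \<open>p \<noteq> []\<close> Cons.prems by auto
    then show ?thesis using Cons.prems(1)[of "x # q" r] by auto
  next
    case False
    then show ?thesis using Cons.prems(1)[of "[x]" p] \<open>p \<noteq> []\<close> Cons.prems by auto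
  qed
qed simp

text \<open>Some edge of a path from \<open>u\<close> to \<open>v\<close> leaves \<open>A\<close>.
  The last two conclusions prepare an exchange: after deleting that edge, joining \<open>u\<close>
  to \<open>v\<close> reconnects \<open>a\<close> and \<open>b\<close>.\<close>

lemma connected_cut_edge:
  assumes N: "N \<subseteq> complete_edges T" and u: "u \<in> T" "u \<in> A" "v \<notin> A" and uv: "(u, v) \<in> (adj N)\<^sup>*"
  obtains a b where "{a, b} \<in> N" "a \<in> A" "b \<notin> A"
    "(u, a) \<in> (adj (N - {{a, b}}))\<^sup>*" "(b, v) \<in> (adj (N - {{a, b}}))\<^sup>*"
proof -
  obtain p where p: "is_path T N p" "hd p = u" "last p = v"
    using uv component_iff[OF N u(1)] unfolding component_def by auto
  then have pp: "p \<noteq> []" "distinct p" "set (path_edges p) \<subseteq> N" unfolding is_path_def by auto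
  obtain q r where qr: "p = q @ r" "q \<noteq> []" "r \<noteq> []" "last q \<in> A" "hd r \<notin> A"
    using list_crossing[of p A] pp p u by auto
  let ?e = "{last q, hd r}"
  have pe: "path_edges p = path_edges q @ ?e # path_edges r"
    using qr path_edges_append2 by auto
  \<comment> \<open>Distinctness of the path ensures that the crossing edge occurs in neither
    remaining piece.\<close>
  have "hd r \<notin> set q" "last q \<notin> set r"
    using pp(2) qr by (auto simp: disjoint_iff)
  then have "?e \<notin> set (path_edges q)" "?e \<notin> set (path_edges r)"
    using path_edges_subset by (metis insert_subset)+
  then have "(hd q, last q) \<in> (adj (N - {?e}))\<^sup>*" "(hd r, last r) \<in> (adj (N - {?e}))\<^sup>*"
    using pp(3) pe qr by (intro walk_connects; auto)+
  moreover have "hd q = u" "last r = v" using p qr by auto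
  moreover have "?e \<in> N" using pp(3) pe by auto
  ultimately show ?thesis using that qr by auto
qed

text \<open>A minimum spanning tree is determined by the order of the costs alone, hence it stays
  minimal under monotone transformations.  Exchanging edges of \<open>N\<close> for edges of \<open>M\<close> never
  increases any such transformed cost.\<close>

lemma minimum_spanning_tree_monotone:
  assumes T: "finite T" and M: "minimum_spanning_tree T (complete_edges T) c M"
    and c: "\<forall>e\<in>complete_edges T. 0 \<le> c e"
    and N: "N \<subseteq> complete_edges T" "in_one_component T N T"
    and \<phi>: "mono (\<phi> :: real \<Rightarrow> real)" "\<And>x. 0 \<le> \<phi> x"
  shows "(\<Sum>e\<in>M. \<phi> (c e)) \<le> (\<Sum>e\<in>N. \<phi> (c e))"
  using N
proof (induction "card (M - N)" arbitrary: N rule: less_induct)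
  case less
  have M': "spanning_tree T (complete_edges T) M" using M unfolding minimum_spanning_tree_def by auto
  have MT: "M \<subseteq> complete_edges T" using M' unfolding spanning_tree_def by auto
  have finM: "finite M" using MT finite_complete_edges[OF T] finite_subset by blast
  have finN: "finite N" using less.prems finite_complete_edges[OF T] finite_subset by blast
  have Mconn: "(s, t) \<in> (adj M)\<^sup>*" if "s \<in> T" "t \<in> T" for s t
    using M' MT that unfolding spanning_tree_def by (auto simp: in_one_component_iff)
  have Nconn: "(s, t) \<in> (adj N)\<^sup>*" if "s \<in> T" "t \<in> T" for s t
    using less.prems that by (auto simp: in_one_component_iff)
  show ?case
  proof (cases "M \<subseteq> N")
    case True
    then show ?thesis using finN \<phi> by (intro sum_mono2) auto
  next
    case False
    then obtain f where f: "f \<in> M" "f \<notin> N" by auto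
    obtain u v where uv: "f = {u, v}" "u \<in> T" "v \<in> T" "u \<noteq> v"
      using f MT complete_edgesE by blast
    \<comment> \<open>Deleting \<open>f\<close> splits the tree \<open>M\<close>; \<open>A\<close>
      is the side of \<open>u\<close>. The path from \<open>u\<close> to \<open>v\<close> in
      \<open>N\<close> supplies an edge \<open>?e\<close> across the same cut.\<close>
    define A where "A = {x. (u, x) \<in> (adj (M - {f}))\<^sup>*}"
    have uA: "u \<in> A" "v \<notin> A"
      using spanning_tree_edge_essential[OF M'] f uv unfolding A_def by auto
    obtain a b where ab: "{a, b} \<in> N" "a \<in> A" "b \<notin> A"
      "(u, a) \<in> (adj (N - {{a, b}}))\<^sup>*" "(b, v) \<in> (adj (N - {{a, b}}))\<^sup>*"
      using connected_cut_edge[OF less.prems(1) uv(2) uA Nconn[OF uv(2,3)]] .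
    let ?e = "{a, b}"
    have eT: "?e \<in> complete_edges T" "b \<in> T" using less.prems ab unfolding complete_edges_def by auto
    have "?e \<noteq> f" using f ab by auto
    have eM: "?e \<notin> M"
    proof
      assume "?e \<in> M"
      then have "(a, b) \<in> adj (M - {f})" using \<open>?e \<noteq> f\<close> by auto
      then show False using ab unfolding A_def by (auto dest: rtrancl_into_rtrancl)
    qed
    \<comment> \<open>The exchange in \<open>M\<close> serves only to derive that \<open>f\<close>
      costs at most as much as \<open>?e\<close>, by minimality of \<open>M\<close>.\<close>
    define M1 where "M1 = insert ?e (M - {f})"
    have "(u, v) \<in> (adj M1)\<^sup>*"
    proof -
      have bv: "(b, v) \<in> (adj (M - {f}))\<^sup>*"
      proof -
        have ub: "(u, b) \<in> (adj M)\<^sup>*" using Mconn uv eT by auto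
        \<comment> \<open>Without \<open>f\<close>, every vertex remains attached to
          \<open>u\<close> or to \<open>v\<close>; since \<open>b\<close> is not on the side of
          \<open>u\<close>, it is on that of \<open>v\<close>.\<close>
        have "x \<in> A \<or> (v, x) \<in> (adj (M - {f}))\<^sup>*" if "(u, x) \<in> (adj M)\<^sup>*" for x
          using that
        proof (induction rule: rtrancl_induct)
          case base
          then show ?case using uA by auto
        next
          case (step y z)
          show ?case
          proof (cases "{y, z} = f")
            case True
            then have "z = u \<or> z = v" using uv by (auto simp: doubleton_eq_iff)
            then show ?thesis using uA by auto
          next
            case False
            then have "(y, z) \<in> adj (M - {f})" using step by auto
            then show ?thesis using step.IH unfolding A_def by (auto dest: rtrancl_into_rtrancl)
          qed
        qed
        from this[OF ub] have "(v, b) \<in> (adj (M - {f}))\<^sup>*" using ab(3) by simp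
        then show ?thesis by (rule adj_rtrancl_sym)
      qed
      have "(u, a) \<in> (adj M1)\<^sup>*" using ab(2) adj_rtrancl_mono[of "M - {f}" M1]
        unfolding A_def M1_def by auto
      moreover have "(a, b) \<in> adj M1" unfolding M1_def by simp
      moreover have "(b, v) \<in> (adj M1)\<^sup>*" using bv adj_rtrancl_mono[of "M - {f}" M1]
        unfolding M1_def by auto
      ultimately show ?thesis by (meson rtrancl_into_rtrancl rtrancl_trans)
    qed
    then have "(s, t) \<in> (adj M1)\<^sup>*" if "s \<in> T" "t \<in> T" for s t
      using adj_rtrancl_exchange[OF _ _ Mconn[OF that], of u v M1] uv unfolding M1_def by auto
    moreover have M1T: "M1 \<subseteq> complete_edges T" using MT eT unfolding M1_def by auto
    ultimately have M1: "in_one_component T M1 T" by (simp add: in_one_component_iff)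
    have "sum c M \<le> sum c M1"
      using minimum_spanning_tree_le_connecting[OF T M c M1T M1] .
    then have cfe: "c f \<le> c ?e"
      using finM f eM unfolding M1_def by (simp add: sum.remove[of M f])
    \<comment> \<open>The opposite exchange in \<open>N\<close> keeps it connecting and does not
      raise the transformed cost. As \<open>?e\<close> is not in \<open>M\<close>, one edge fewer of
      \<open>M\<close> is missing, so the induction applies.\<close>
    define N1 where "N1 = insert f (N - {?e})"
    have sub: "(x, y) \<in> (adj N1)\<^sup>*" if "(x, y) \<in> (adj (N - {?e}))\<^sup>*" for x y
      using that adj_rtrancl_mono[of "N - {?e}" N1] unfolding N1_def by auto
    have abN1: "(a, b) \<in> (adj N1)\<^sup>*"
    proof -
      have "(a, u) \<in> (adj N1)\<^sup>*" by (rule adj_rtrancl_sym[OF sub[OF ab(4)]])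
      moreover have "(u, v) \<in> adj N1" unfolding N1_def uv by simp
      moreover have "(v, b) \<in> (adj N1)\<^sup>*" by (rule adj_rtrancl_sym[OF sub[OF ab(5)]])
      ultimately show ?thesis by (meson rtrancl_into_rtrancl rtrancl_trans)
    qed
    have "(s, t) \<in> (adj N1)\<^sup>*" if "s \<in> T" "t \<in> T" for s t
      using adj_rtrancl_exchange[OF abN1 _ Nconn[OF that]] unfolding N1_def by auto
    moreover have N1T: "N1 \<subseteq> complete_edges T" using less.prems MT f unfolding N1_def by auto
    ultimately have N1: "in_one_component T N1 T" by (simp add: in_one_component_iff)
    have "M - N1 = (M - N) - {f}" using eM unfolding N1_def by auto
    then have "card (M - N1) < card (M - N)"
      using f finM by (simp add: card_Diff1_less del: card_Diff_insert)
    then have "(\<Sum>e\<in>M. \<phi> (c e)) \<le> (\<Sum>e\<in>N1. \<phi> (c e))" using less.hyps N1T N1 by auto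
    also have "\<dots> = \<phi> (c f) + (\<Sum>e\<in>N - {?e}. \<phi> (c e))"
      using finN f unfolding N1_def by simp
    also have "\<dots> \<le> \<phi> (c ?e) + (\<Sum>e\<in>N - {?e}. \<phi> (c e))"
      using \<phi>(1) cfe by (simp add: monoD)
    also have "\<dots> = (\<Sum>e\<in>N. \<phi> (c e))" using finN ab(1) by (simp add: sum.remove)
    finally show ?thesis .
  qed
qed

lemma complete_edges_empty: "complete_edges {} = {}"
  unfolding complete_edges_def by (auto dest: subset_empty[THEN iffD1])

text \<open>The constant function 1 is monotone, so \<open>minimum_spanning_tree_monotone\<close>
  compares numbers of edges; the competitor is a star. For empty \<open>T\<close> the truncated
  subtraction gives 0, and there are no edges.\<close>

lemma minimum_spanning_tree_card:
  assumes T: "finite T" and M: "minimum_spanning_tree T (complete_edges T) c M"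
    and c: "\<forall>e\<in>complete_edges T. 0 \<le> c e"
  shows "card M \<le> card T - 1"
proof (cases "T = {}")
  case True
  then have "M = {}"
    using M complete_edges_empty unfolding minimum_spanning_tree_def spanning_tree_def by blast
  then show ?thesis by simp
next
  case False
  then obtain r where r: "r \<in> T" by auto
  define N where "N = (\<lambda>t. {r, t}) ` (T - {r})"
  have NT: "N \<subseteq> complete_edges T" using r unfolding N_def complete_edges_def by auto
  have star: "(r, t) \<in> (adj N)\<^sup>*" if "t \<in> T" for t
    using that unfolding N_def by (cases "t = r") auto
  have "(s, t) \<in> (adj N)\<^sup>*" if "s \<in> T" "t \<in> T" for s t
    using rtrancl_trans[OF adj_rtrancl_sym[OF star[OF that(1)]] star[OF that(2)]] .
  then have "in_one_component T N T" using NT by (simp add: in_one_component_iff)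
  then have "(\<Sum>e\<in>M. 1 :: real) \<le> (\<Sum>e\<in>N. 1)"
    using minimum_spanning_tree_monotone[OF T M c NT, of "\<lambda>_. 1"] by (simp add: mono_def)
  then have "card M \<le> card N" by simp
  also have "\<dots> \<le> card (T - {r})" unfolding N_def using T by (intro card_image_le) auto
  also have "\<dots> = card T - 1" using r T by simp
  finally show ?thesis .
qed

text \<open>The sum of the \<open>m\<close> largest costs with threshold \<open>x\<close> is \<open>m x + \<Sum> max 0 (c e - x)\<close>, and
  the truncated costs are a monotone transformation of the costs.\<close>

lemma minimum_spanning_tree_highest_cost:
  assumes T: "finite T" and M: "minimum_spanning_tree T (complete_edges T) c M"
    and c: "\<forall>e\<in>complete_edges T. 0 \<le> c e"
    and N: "N \<subseteq> complete_edges T" "in_one_component T N T"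
    and le: "\<forall>e\<in>complete_edges T. c e \<le> c' e"
    and S: "highest_cost_subset c' N m S" and F: "F \<subseteq> M" "card F \<le> m"
  shows "sum c F \<le> sum c' S"
proof -
  have MT: "M \<subseteq> complete_edges T"
    using M unfolding minimum_spanning_tree_def spanning_tree_def by auto
  have finM: "finite M" and finN: "finite N"
    using MT N(1) finite_complete_edges[OF T] finite_subset by blast+
  then have finF: "finite F" using F finite_subset by blast
  have SN: "S \<subseteq> N" "card S = m" "\<forall>e\<in>S. \<forall>f\<in>N - S. c' f \<le> c' e"
    using S unfolding highest_cost_subset_def by auto
  have finS: "finite S" using SN finN finite_subset by blast
  show ?thesis
  proof (cases "S = {}")
    \<comment> \<open>\<open>Min\<close> over \<open>S\<close> would be meaningless here; an empty
      \<open>S\<close> forces \<open>m = 0\<close>, hence an empty \<open>F\<close>.\<close>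
    case True
    then have "F = {}" using F SN finF by auto
    then show ?thesis using True by simp
  next
    case False
    define x where "x = Min (c' ` S)"
    define \<phi> where "\<phi> y = max 0 (y - x)" for y :: real
    have \<phi>: "mono \<phi>" "\<And>y. 0 \<le> \<phi> y" unfolding \<phi>_def mono_def by auto
    have xin: "x \<in> c' ` S" unfolding x_def using finS False by (intro Min_in) auto
    have xle: "x \<le> c' e" if "e \<in> S" for e unfolding x_def using finS that by auto
    have out: "c' f \<le> x" if "f \<in> N - S" for f using xin SN(3) that by auto
    \<comment> \<open>The sign of the threshold permits replacing \<open>card F\<close> by the
      possibly larger \<open>m\<close> below.\<close>
    have x0: "0 \<le> x"
    proof -
      obtain e where "e \<in> S" "x = c' e" using xin by auto
      moreover from this have "e \<in> complete_edges T" using SN N by auto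
      ultimately show ?thesis using c le by (metis order_trans)
    qed
    have "sum c F \<le> (\<Sum>e\<in>F. x + \<phi> (c e))" unfolding \<phi>_def by (intro sum_mono) auto
    also have "\<dots> = card F * x + (\<Sum>e\<in>F. \<phi> (c e))" by (simp add: sum.distrib)
    also have "\<dots> \<le> m * x + (\<Sum>e\<in>M. \<phi> (c e))"
      using F finM \<phi> x0 by (intro add_mono mult_right_mono sum_mono2) auto
    also have "\<dots> \<le> m * x + (\<Sum>e\<in>N. \<phi> (c e))"
      using minimum_spanning_tree_monotone[OF T M c N \<phi>] by simp
    also have "\<dots> \<le> m * x + (\<Sum>e\<in>N. \<phi> (c' e))"
      using le N(1) \<phi>(1) by (intro add_left_mono sum_mono) (auto simp: mono_def)
    \<comment> \<open>Edges of \<open>N\<close> outside \<open>S\<close> cost at most the threshold,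
      so their truncated cost vanishes.\<close>
    also have "(\<Sum>e\<in>N. \<phi> (c' e)) = (\<Sum>e\<in>S. \<phi> (c' e))"
      using finN SN(1) out by (intro sum.mono_neutral_right) (auto simp: \<phi>_def)
    also have "\<dots> = (\<Sum>e\<in>S. c' e - x)" using xle by (intro sum.cong) (auto simp: \<phi>_def)
    also have "m * x + \<dots> = sum c' S" using SN(2) by (simp add: sum_subtractf)
    finally show ?thesis .
  qed
qed

subsection \<open>Shortest path distances\<close>

lemma finite_paths_between:
  assumes "finite V" shows "finite (paths_between V E e)"
proof (rule finite_subset)
  show "paths_between V E e \<subseteq> {xs. set xs \<subseteq> V \<and> length xs \<le> card V}"
    unfolding paths_between_def is_path_def using assms
    by (auto simp: distinct_card[symmetric] card_mono)
  show "finite {xs. set xs \<subseteq> V \<and> length xs \<le> card V}"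
    using finite_lists_length_le[OF assms] .
qed

lemma pair_dist_le:
  "finite V \<Longrightarrow> p \<in> paths_between V E e \<Longrightarrow> pair_dist V E w e \<le> path_cost w p"
  unfolding pair_dist_def using finite_paths_between by (intro Min_le) auto

lemma pair_dist_attained:
  assumes "finite V" "paths_between V E e \<noteq> {}"
  obtains p where "p \<in> paths_between V E e" "path_cost w p = pair_dist V E w e"
proof -
  have "pair_dist V E w e \<in> path_cost w ` paths_between V E e"
    unfolding pair_dist_def using assms finite_paths_between by (intro Min_in) auto
  then show ?thesis using that by auto
qed

lemma cheapest_path_cost:
  assumes "finite V" "cheapest_path V E w e p"
  shows "path_cost w p = pair_dist V E w e"
proof -
  have p: "p \<in> paths_between V E e" using assms unfolding cheapest_path_def by auto
  then obtain q where "q \<in> paths_between V E e" "path_cost w q = pair_dist V E w e"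
    using pair_dist_attained[OF assms(1)] by blast
  then have "path_cost w p \<le> pair_dist V E w e" using assms unfolding cheapest_path_def by metis
  then show ?thesis using pair_dist_le[OF assms(1) p, of w] by simp
qed

text \<open>Since \<open>paths_between\<close> refers to an unordered pair, the path may have to be
  reversed before it can be concatenated or followed from \<open>x\<close>.\<close>

lemma path_between_oriented:
  assumes "p \<in> paths_between V E {x, y}"
  obtains q where "is_path V E q" "hd q = x" "last q = y" "path_cost w q = path_cost w p"
    "set (path_edges q) = set (path_edges p)"
proof -
  have p: "is_path V E p" "{hd p, last p} = {x, y}" using assms unfolding paths_between_def by auto
  then have "hd p = x \<and> last p = y \<or> hd p = y \<and> last p = x" by (simp add: doubleton_eq_iff)
  then show ?thesis
  proof
    assume "hd p = x \<and> last p = y"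
    then show ?thesis using that[of p] p by auto
  next
    assume "hd p = y \<and> last p = x"
    moreover have "is_path V E (rev p)" using p unfolding is_path_def by (simp add: path_edges_rev)
    ultimately show ?thesis
      using that[of "rev p"] p by (simp add: path_cost_rev path_edges_rev hd_rev last_rev)
  qed
qed

lemma paths_between_nonempty:
  assumes "ugraph V E" "x \<in> V" "(x, y) \<in> (adj E)\<^sup>*"
  shows "paths_between V E {x, y} \<noteq> {}"
proof -
  have "y \<in> component V E x" using assms component_iff[of E V x y] unfolding ugraph_def by simp
  then show ?thesis unfolding component_def paths_between_def by auto
qed

lemma pair_dist_le_walk:
  assumes "finite V" "\<forall>e\<in>E. 0 \<le> w e" "p \<noteq> []" "set p \<subseteq> V" "set (path_edges p) \<subseteq> E"
  shows "pair_dist V E w {hd p, last p} \<le> path_cost w p"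
proof -
  obtain q where q: "q \<noteq> []" "distinct q" "hd q = hd p" "last q = last p" "set q \<subseteq> set p"
    "set (path_edges q) \<subseteq> set (path_edges p)"
    "\<And>w. (\<forall>e\<in>set (path_edges p). 0 \<le> w e) \<Longrightarrow> path_cost w q \<le> path_cost w p"
    using walk_contains_path[OF assms(3)] by blast
  have "q \<in> paths_between V E {hd p, last p}"
    using q assms unfolding paths_between_def is_path_def by auto
  then have "pair_dist V E w {hd p, last p} \<le> path_cost w q" using pair_dist_le assms(1) by blast
  also have "\<dots> \<le> path_cost w p" using q(7) assms(2,5) by auto
  finally show ?thesis .
qed

lemma pair_dist_nonneg:
  assumes "ugraph V E" "\<forall>e\<in>E. 0 \<le> w e" "x \<in> V" "(x, y) \<in> (adj E)\<^sup>*"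
  shows "0 \<le> pair_dist V E w {x, y}"
proof -
  have "finite V" using assms unfolding ugraph_def by auto
  then obtain p where p: "p \<in> paths_between V E {x, y}" "path_cost w p = pair_dist V E w {x, y}"
    using pair_dist_attained paths_between_nonempty[OF assms(1,3,4)] by blast
  have "set (path_edges p) \<subseteq> E" using p(1) unfolding paths_between_def is_path_def by auto
  then have "0 \<le> path_cost w p" using assms(2) by (intro path_cost_nonneg) auto
  then show ?thesis using p(2) by simp
qed

text \<open>Two shortest paths joined at \<open>y\<close> form a walk, possibly with repeated
  vertices, which \<open>pair_dist_le_walk\<close> accepts.\<close>

lemma pair_dist_triangle:
  assumes G: "ugraph V E" and w: "\<forall>e\<in>E. 0 \<le> w e" and V: "x \<in> V" "y \<in> V"
    and xy: "(x, y) \<in> (adj E)\<^sup>*" and yz: "(y, z) \<in> (adj E)\<^sup>*"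
  shows "pair_dist V E w {x, z} \<le> pair_dist V E w {x, y} + pair_dist V E w {y, z}"
proof -
  have fin: "finite V" using G unfolding ugraph_def by auto
  obtain p0 where p0: "p0 \<in> paths_between V E {x, y}" "path_cost w p0 = pair_dist V E w {x, y}"
    using pair_dist_attained[OF fin paths_between_nonempty[OF G V(1) xy]] .
  obtain p where p: "is_path V E p" "hd p = x" "last p = y" "path_cost w p = path_cost w p0"
    using path_between_oriented[OF p0(1)] by metis
  obtain q0 where q0: "q0 \<in> paths_between V E {y, z}" "path_cost w q0 = pair_dist V E w {y, z}"
    using pair_dist_attained[OF fin paths_between_nonempty[OF G V(2) yz]] .
  obtain q where q: "is_path V E q" "hd q = y" "last q = z" "path_cost w q = path_cost w q0"
    using path_between_oriented[OF q0(1)] by metis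
  obtain p' where p': "p = p' @ [y]"
    using p unfolding is_path_def by (metis append_butlast_last_id)
  obtain q' where q': "q = y # q'"
    using q unfolding is_path_def by (metis list.collapse)
  let ?r = "p' @ y # q'"
  have r: "path_edges ?r = path_edges p @ path_edges q"
    unfolding p' q' by (rule path_edges_append)
  have "hd ?r = x" using p(2) p' by (cases p') auto
  moreover have "last ?r = z" using q(3) q' by auto
  moreover have "set ?r \<subseteq> V" "set (path_edges ?r) \<subseteq> E"
    using p(1) q(1) unfolding r unfolding is_path_def p' q' by auto
  ultimately have "pair_dist V E w {x, z} \<le> path_cost w ?r"
    using pair_dist_le_walk[OF fin w, of ?r] by auto
  also have "\<dots> = path_cost w p + path_cost w q" unfolding path_cost_def r by simp
  finally show ?thesis using p p0 q q0 by simp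
qed

lemma pair_dist_mono:
  assumes G: "ugraph V E" and V: "x \<in> V" "(x, y) \<in> (adj E)\<^sup>*" and le: "\<forall>e\<in>E. w e \<le> w' e"
  shows "pair_dist V E w {x, y} \<le> pair_dist V E w' {x, y}"
proof -
  have fin: "finite V" using G unfolding ugraph_def by auto
  obtain p where p: "p \<in> paths_between V E {x, y}" "path_cost w' p = pair_dist V E w' {x, y}"
    using pair_dist_attained[OF fin paths_between_nonempty[OF G V]] .
  have "set (path_edges p) \<subseteq> E" using p(1) unfolding paths_between_def is_path_def by auto
  then have "path_cost w p \<le> path_cost w' p"
    unfolding path_cost_def using le by (intro sum_list_mono) auto
  then show ?thesis using pair_dist_le[OF fin p(1), of w] p(2) by simp
qed

lemma sum_set_le_sum_list:
  fixes f :: "'b \<Rightarrow> real"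
  shows "\<forall>x\<in>set xs. 0 \<le> f x \<Longrightarrow> sum f (set xs) \<le> sum_list (map f xs)"
proof (induction xs)
  case (Cons x xs)
  then show ?case by (cases "x \<in> set xs") (auto simp: insert_absorb)
qed simp

lemma path_edges_doubleton:
  "e \<in> set (path_edges p) \<Longrightarrow> \<exists>x\<in>set p. \<exists>y\<in>set p. e = {x, y}"
  by (induction p rule: path_edges.induct) auto

subsection \<open>Spanning trees from Steiner trees\<close>

lemma path_cost_Cons_Cons: "path_cost d (x # y # p) = d {x, y} + path_cost d (y # p)"
  by (simp add: path_cost_def)

text \<open>Shortcutting: skipping an inner vertex is paid for by the triangle inequality, skipping
  the last one by nonnegativity. The first vertex always stays.\<close>

lemma path_cost_filter_le:
  assumes d0: "\<And>x y. x \<in> C \<Longrightarrow> y \<in> C \<Longrightarrow> 0 \<le> d {x, y}"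
    and tri: "\<And>x y z. x \<in> C \<Longrightarrow> y \<in> C \<Longrightarrow> z \<in> C \<Longrightarrow> d {x, z} \<le> d {x, y} + d {y, z}"
    and C: "x \<in> C" "set p \<subseteq> C"
  shows "path_cost d (x # filter P p) \<le> path_cost d (x # p)"
  using C
proof (induction p arbitrary: x)
  case (Cons y p)
  show ?case
  proof (cases "P y")
    case True
    then show ?thesis using Cons by (simp add: path_cost_Cons_Cons)
  next
    case False
    then have "path_cost d (x # filter P (y # p)) \<le> path_cost d (x # p)" using Cons by simp
    also have "\<dots> \<le> path_cost d (x # y # p)"
    proof (cases p)
      case Nil
      then show ?thesis using d0[of x y] Cons.prems by (simp add: path_cost_def)
    next
      case (Cons z p')
      then show ?thesis using tri[of x y z] \<open>x \<in> C\<close> \<open>set (y # p) \<subseteq> C\<close>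
        by (simp add: path_cost_Cons_Cons)
    qed
    finally show ?thesis .
  qed
qed simp

lemma reachable_subset:
  assumes "X \<subseteq> complete_edges V" "r \<in> V"
  shows "{v. (r, v) \<in> (adj X)\<^sup>*} \<subseteq> V"
proof
  fix v assume "v \<in> {v. (r, v) \<in> (adj X)\<^sup>*}"
  then have "(r, v) \<in> (adj X)\<^sup>*" by simp
  then show "v \<in> V" using assms
    by (induction rule: rtrancl_induct) (auto simp: complete_edges_def)
qed

text \<open>The tour is grown by detours \<open>a, b, a\<close> to unvisited neighbours \<open>b\<close>; each of them uses up an
  edge \<open>{a, b}\<close> that has not been used before.\<close>

lemma tour_exists:
  assumes fin: "finite V" and X: "X \<subseteq> complete_edges V" and r: "r \<in> V"
    and w: "\<forall>e\<in>X. 0 \<le> w e"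
    and d: "\<forall>e\<in>X. d e \<le> w e"
  obtains W where "set (r # W) = {v. (r, v) \<in> (adj X)\<^sup>*}" "path_cost d (r # W) \<le> 2 * sum w X"
proof -
  define C where "C = {v. (r, v) \<in> (adj X)\<^sup>*}"
  have "C \<subseteq> V" unfolding C_def using X r by (rule reachable_subset)
  then have finC: "finite C" using fin finite_subset by blast
  have finX: "finite X" using X finite_complete_edges[OF fin] finite_subset by blast
  \<comment> \<open>Invariant of the growing tour: \<open>Y\<close> holds the edges already paid
    for, all of them between visited vertices. Hence an edge to an unvisited vertex is never in
    \<open>Y\<close>.\<close>
  have "\<exists>W'. set (r # W') = C \<and> path_cost d (r # W') \<le> 2 * sum w X"
    if "set (r # W) \<subseteq> C" "Y \<subseteq> X" "\<forall>e\<in>Y. e \<subseteq> set (r # W)"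
      "path_cost d (r # W) \<le> 2 * sum w Y" for W Y
    using that
  proof (induction "card (C - set (r # W))" arbitrary: W Y rule: less_induct)
    case less
    show ?case
    proof (cases "C \<subseteq> set (r # W)")
      case True
      have "sum w Y \<le> sum w X" using less.prems(2) finX w by (intro sum_mono2) auto
      then show ?thesis using True less.prems by (intro exI[of _ W]) auto
    next
      case False
      then obtain v where v: "v \<in> C" "v \<notin> set (r # W)" by auto
      have rv: "(r, v) \<in> (adj X)\<^sup>*" using v unfolding C_def by simp
      have "r \<in> set (r # W)" by simp
      then obtain a b where ab: "{a, b} \<in> X" "a \<in> set (r # W)" "b \<notin> set (r # W)"
        using connected_cut_edge[OF X r _ v(2) rv] by blast
      obtain W1 W2 where W12: "r # W = W1 @ a # W2" using split_list[OF ab(2)] by auto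
      have "hd (W1 @ a # b # a # W2) = hd (W1 @ a # W2)" by (cases W1) auto
      then have "hd (W1 @ a # b # a # W2) = r" using W12 by (metis list.sel(1))
      then obtain W' where W': "r # W' = W1 @ a # b # a # W2"
        by (metis append_is_Nil_conv list.collapse list.distinct(1))
      have sW': "set (r # W') = insert b (set (r # W))" unfolding W' W12 by auto
      have "a \<in> C" using ab(2) less.prems(1) by auto
      then have bC: "b \<in> C" using ab(1) unfolding C_def by (auto intro: rtrancl_into_rtrancl)
      have eY: "{a, b} \<notin> Y" using less.prems(3) ab(3) by auto
      have finY: "finite Y" using less.prems(2) finX finite_subset by blast
      have "path_edges (r # W') = path_edges (W1 @ [a]) @ {a, b} # {b, a} # path_edges (a # W2)"
        unfolding W' by (subst path_edges_append) simp
      moreover have "path_edges (r # W) = path_edges (W1 @ [a]) @ path_edges (a # W2)"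
        unfolding W12 by (rule path_edges_append)
      ultimately have "path_cost d (r # W') = path_cost d (r # W) + 2 * d {a, b}"
        by (simp add: path_cost_def insert_commute)
      also have "\<dots> \<le> 2 * sum w Y + 2 * w {a, b}" using less.prems(4) d ab(1) by auto
      also have "\<dots> = 2 * sum w (insert {a, b} Y)" using eY finY by simp
      finally have cost: "path_cost d (r # W') \<le> 2 * sum w (insert {a, b} Y)" .
      show ?thesis
      proof (rule less.hyps[OF _ _ _ _ cost])
        have "C - set (r # W') = (C - set (r # W)) - {b}" unfolding sW' by auto
        moreover have "b \<in> C - set (r # W)" using bC ab(3) by auto
        ultimately show "card (C - set (r # W')) < card (C - set (r # W))"
          using finC by (metis card_Diff1_less finite_Diff)
        show "set (r # W') \<subseteq> C" using sW' bC less.prems(1) by auto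
        show "insert {a, b} Y \<subseteq> X" using ab(1) less.prems(2) by auto
        show "\<forall>e\<in>insert {a, b} Y. e \<subseteq> set (r # W')" using sW' ab(2) less.prems(3) by blast
      qed
    qed
  qed
  from this[of "[]" "{}"] show ?thesis using that unfolding C_def by (auto simp: path_cost_def)
qed

text \<open>Reducing a tour of the component of \<open>X\<close> that contains the terminals to its
  visits of terminals does not increase its length, and the remaining steps connect
  \<open>T\<close>.\<close>

lemma terminal_mst_le_twice_steiner_tree:
  assumes G: "ugraph V E" and w: "\<forall>e\<in>E. 0 \<le> w e" and T: "T \<subseteq> V"
    and X: "steiner_tree V E T X" and M: "terminal_mst V E w T M"
  shows "sum (pair_dist V E w) M \<le> 2 * sum w X"
proof (cases "T = {}")
  case True
  then have "M = {}" using M complete_edges_empty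
    unfolding terminal_mst_def minimum_spanning_tree_def spanning_tree_def by blast
  moreover have "0 \<le> sum w X"
    using X w unfolding steiner_tree_def by (intro sum_nonneg) auto
  ultimately show ?thesis by simp
next
  case False
  let ?d = "pair_dist V E w"
  obtain r where r: "r \<in> T" using False by auto
  then have rV: "r \<in> V" using T by auto
  have fin: "finite V" and EV: "E \<subseteq> complete_edges V" using G unfolding ugraph_def by auto
  have finT: "finite T" using fin T finite_subset by blast
  have XE: "X \<subseteq> E" and conn: "in_one_component V X T" using X unfolding steiner_tree_def by auto
  have XV: "X \<subseteq> complete_edges V" using XE EV by auto
  have dw: "\<forall>e\<in>X. ?d e \<le> w e"
  proof
    fix e assume e: "e \<in> X"
    then have "e \<in> complete_edges V" using XV by auto
    then obtain x y where "e = {x, y}" "x \<in> V" "y \<in> V" by (rule complete_edgesE)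
    then show "?d e \<le> w e"
      using pair_dist_le_walk[OF fin w, of "[x, y]"] e XE by (auto simp: path_cost_def)
  qed
  define C where "C = {v. (r, v) \<in> (adj X)\<^sup>*}"
  obtain W where W: "set (r # W) = C" "path_cost ?d (r # W) \<le> 2 * sum w X"
  proof (rule tour_exists[OF fin XV rV _ dw])
    show "\<forall>e\<in>X. 0 \<le> w e" using w XE by auto
  qed (auto simp: C_def)
  have CV: "C \<subseteq> V" unfolding C_def using XV rV by (rule reachable_subset)
  have CC: "(x, y) \<in> (adj E)\<^sup>*" if "x \<in> C" "y \<in> C" for x y
  proof -
    have "(r, x) \<in> (adj E)\<^sup>*" "(r, y) \<in> (adj E)\<^sup>*"
      using that adj_rtrancl_mono[OF XE] unfolding C_def by auto
    then show ?thesis using adj_rtrancl_sym rtrancl_trans by metis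
  qed
  have d0: "0 \<le> ?d {x, y}" if "x \<in> C" "y \<in> C" for x y
    using pair_dist_nonneg[OF G w _ CC[OF that]] that CV by auto
  have tri: "?d {x, z} \<le> ?d {x, y} + ?d {y, z}" if "x \<in> C" "y \<in> C" "z \<in> C" for x y z
    using pair_dist_triangle[OF G w _ _ CC CC] that CV by auto
  have TC: "T \<subseteq> C"
    using conn r XV T unfolding C_def by (auto simp: in_one_component_iff)
  define q where "q = r # filter (\<lambda>x. x \<in> T) W"
  have sq: "set q = T" using W(1) TC r unfolding q_def by auto
  have "r \<in> C" "set W \<subseteq> C" using W(1) by auto
  then have qle: "path_cost ?d q \<le> path_cost ?d (r # W)"
    unfolding q_def by (intro path_cost_filter_le[where C = C and d = ?d] d0 tri) auto
  \<comment> \<open>The tour may visit a terminal twice in a row after filtering, which produces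
    singleton edges. Dropping them affects neither connectivity nor the upper bound.\<close>
  define N where "N = {e \<in> set (path_edges q). card e = 2}"
  have NT: "N \<subseteq> complete_edges T"
    unfolding N_def complete_edges_def using path_edges_subset[of _ q] sq by auto
  have "(r, t) \<in> (adj (set (path_edges q)))\<^sup>*" if t: "t \<in> T" for t
  proof -
    have "t \<in> set q" using t sq by simp
    then obtain q1 q2 where q12: "q = q1 @ t # q2" by (meson split_list)
    have "hd (q1 @ [t]) = hd q" unfolding q12 by (cases q1) auto
    moreover have "hd q = r" unfolding q_def by simp
    moreover have "set (path_edges (q1 @ [t])) \<subseteq> set (path_edges q)"
      unfolding q12 path_edges_append[of q1 t q2] by auto
    ultimately show ?thesis using walk_connects[of "q1 @ [t]" "set (path_edges q)"] by simp
  qed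
  moreover have "(x, y) \<in> (adj N)\<^sup>*" if "{x, y} \<in> set (path_edges q)" for x y
    using that unfolding N_def by (cases "x = y") auto
  ultimately have rN: "(r, t) \<in> (adj N)\<^sup>*" if "t \<in> T" for t
    using adj_rtrancl_subst[of "set (path_edges q)" N] that by metis
  have "(s, t) \<in> (adj N)\<^sup>*" if "s \<in> T" "t \<in> T" for s t
    using rtrancl_trans[OF adj_rtrancl_sym[OF rN[OF that(1)]] rN[OF that(2)]] .
  then have Nconn: "in_one_component T N T" using NT by (simp add: in_one_component_iff)
  have dT: "\<forall>e\<in>complete_edges T. 0 \<le> ?d e"
  proof
    fix e assume "e \<in> complete_edges T"
    then obtain x y where "e = {x, y}" "x \<in> T" "y \<in> T" by (rule complete_edgesE)
    then show "0 \<le> ?d e" using d0 TC by auto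
  qed
  have dq: "\<forall>e\<in>set (path_edges q). 0 \<le> ?d e"
    using path_edges_doubleton[of _ q] sq TC d0 by blast
  have "sum ?d M \<le> sum ?d N"
    using minimum_spanning_tree_le_connecting[OF finT _ dT NT Nconn] M
    unfolding terminal_mst_def by auto
  also have "\<dots> \<le> sum ?d (set (path_edges q))"
    using dq unfolding N_def by (intro sum_mono2) auto
  also have "\<dots> \<le> path_cost ?d q"
    unfolding path_cost_def using dq by (rule sum_set_le_sum_list)
  finally show ?thesis using qle W(2) by simp
qed

subsection \<open>The approximation bound\<close>

text \<open>An edge shared by several paths, or repeated in one list, is counted once on the left
  but repeatedly on the right.\<close>

lemma sum_path_union_le:
  fixes w :: "'a set \<Rightarrow> real"
  assumes "finite F" "\<forall>f\<in>F. \<forall>e\<in>set (path_edges (P f)). 0 \<le> w e"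
  shows "sum w (\<Union>f\<in>F. set (path_edges (P f))) \<le> (\<Sum>f\<in>F. path_cost w (P f))"
  using assms
proof (induction F rule: finite_induct)
  case (insert f F)
  let ?A = "set (path_edges (P f))" and ?B = "\<Union>f\<in>F. set (path_edges (P f))"
  have "sum w (?A \<union> ?B) = sum w ?A + sum w ?B - sum w (?A \<inter> ?B)"
    using insert.hyps by (intro sum_Un) auto
  moreover have "0 \<le> sum w (?A \<inter> ?B)" using insert.prems by (intro sum_nonneg) auto
  moreover have "sum w ?A \<le> path_cost w (P f)"
    unfolding path_cost_def using insert.prems by (intro sum_set_le_sum_list) auto
  ultimately show ?case using insert by auto
qed simp

theorem theorem3:
  fixes V T :: "'a set"
    and E Xhat X X' MST S :: "'a set set"
    and w :: "'a set \<Rightarrow> real"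
    and \<alpha> \<eta>_plus \<eta>_minus :: real
    and k :: nat
  assumes graph: "ugraph V E"
    and weights: "\<forall>e\<in>E. 0 \<le> w e"
    and terminals: "T \<subseteq> V" "card T = k"
    and connected: "in_one_component V E T"
    and prediction: "Xhat \<subseteq> E"
    and alpha: "1 \<le> \<alpha>"
    and alg: "algorithm_output V E w T Xhat \<alpha> X"
    and steiner: "steiner_tree V E T X'"
    and eta_plus: "\<eta>_plus = sum w (Xhat - X')"
    and eta_minus: "\<eta>_minus = sum w (X' - Xhat)"
    and mst: "terminal_mst V E w T MST"
    and S: "highest_cost_subset (pair_dist V E w) MST (min (k - 1) (card (Xhat - X'))) S"
  shows "steiner_tree V E T X \<and>
    sum w X \<le> (1 + 1 / \<alpha>) * sum w X' + (1 - 1 / \<alpha>) * \<eta>_minus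
      + min \<eta>_plus ((\<alpha> - 1) * (\<Sum>e\<in>S. pair_dist V E w e))"
proof -
  let ?w = "scaled_weight w Xhat \<alpha>"
  let ?c = "pair_dist V E ?w"
  obtain M P where M: "terminal_mst V E ?w T M"
    and P: "\<forall>e\<in>M. cheapest_path V E ?w e (P e)"
    and Xeq: "X = (\<Union>e\<in>M. set (path_edges (P e)))"
    using alg unfolding algorithm_output_def by blast
  have finV: "finite V" and EV: "E \<subseteq> complete_edges V" using graph unfolding ugraph_def by auto
  have finE: "finite E" using EV finite_complete_edges[OF finV] finite_subset by blast
  have finT: "finite T" using finV terminals finite_subset by blast
  have M': "minimum_spanning_tree T (complete_edges T) ?c M" using M unfolding terminal_mst_def .
  then have MT: "M \<subseteq> complete_edges T" and Mconn: "in_one_component T M T"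
    unfolding minimum_spanning_tree_def spanning_tree_def by auto
  have finM: "finite M" using MT finite_complete_edges[OF finT] finite_subset by blast
  have MSTT: "MST \<subseteq> complete_edges T" "in_one_component T MST T"
    using mst unfolding terminal_mst_def minimum_spanning_tree_def spanning_tree_def by auto
  have w0: "\<forall>e\<in>E. 0 \<le> ?w e" using weights alpha unfolding scaled_weight_def by auto
  have wle: "\<forall>e\<in>E. ?w e \<le> w e"
    using weights alpha unfolding scaled_weight_def by (auto simp: divide_le_eq mult_le_cancel_left1)
  have TE: "(s, t) \<in> (adj E)\<^sup>*" if "s \<in> T" "t \<in> T" for s t
    using connected that EV terminals by (auto simp: in_one_component_iff)
  have c0: "\<forall>e\<in>complete_edges T. 0 \<le> ?c e"
  proof
    fix e assume "e \<in> complete_edges T"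
    then obtain x y where "e = {x, y}" "x \<in> T" "y \<in> T" by (rule complete_edgesE)
    then show "0 \<le> ?c e" using pair_dist_nonneg[OF graph w0 _ TE] terminals by auto
  qed
  have cle: "\<forall>e\<in>complete_edges T. ?c e \<le> pair_dist V E w e"
  proof
    fix e assume "e \<in> complete_edges T"
    then obtain x y where "e = {x, y}" "x \<in> T" "y \<in> T" by (rule complete_edgesE)
    then show "?c e \<le> pair_dist V E w e"
      using pair_dist_mono[OF graph _ TE wle] terminals by auto
  qed
  have Pp: "P e \<in> paths_between V E e" if "e \<in> M" for e
    using P that unfolding cheapest_path_def by auto
  have PE: "set (path_edges (P e)) \<subseteq> E" if "e \<in> M" for e
    using Pp[OF that] unfolding paths_between_def is_path_def by auto
  have Pc: "path_cost ?w (P e) = ?c e" if "e \<in> M" for e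
    using cheapest_path_cost[OF finV] P that by auto
  have XE: "X \<subseteq> E" using PE Xeq by auto
  have finX: "finite X" using XE finE finite_subset by blast
  have X'E: "X' \<subseteq> E" using steiner unfolding steiner_tree_def by auto
  have finX': "finite X'" and finXhat: "finite Xhat"
    using X'E prediction finE finite_subset by blast+

  \<comment> \<open>Every tree edge is replaced by its cheapest path, so connectivity of
    \<open>M\<close> on \<open>T\<close> carries over to \<open>X\<close>.\<close>
  have "(x, y) \<in> (adj X)\<^sup>*" if xy: "{x, y} \<in> M" for x y
  proof -
    obtain q where q: "is_path V E q" "hd q = x" "last q = y"
      "set (path_edges q) = set (path_edges (P {x, y}))"
      using path_between_oriented[OF Pp[OF xy]] by metis
    have "set (path_edges q) \<subseteq> X" using q(4) xy Xeq by auto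
    then show ?thesis using walk_connects[of q X] q unfolding is_path_def by auto
  qed
  then have "(s, t) \<in> (adj X)\<^sup>*" if "s \<in> T" "t \<in> T" for s t
    using adj_rtrancl_subst[of M X s t] Mconn MT that by (simp add: in_one_component_iff)
  then have st: "steiner_tree V E T X"
    unfolding steiner_tree_def using XE EV terminals by (simp add: in_one_component_iff)

  have wX: "sum ?w X \<le> 2 * sum ?w X'"
  proof -
    have "sum ?w X \<le> (\<Sum>e\<in>M. path_cost ?w (P e))"
      unfolding Xeq using finM PE w0 by (intro sum_path_union_le) auto
    also have "\<dots> = sum ?c M" using Pc by simp
    also have "\<dots> \<le> 2 * sum ?w X'"
      using terminal_mst_le_twice_steiner_tree[OF graph w0 terminals(1) steiner M] .
    finally show ?thesis .
  qed

  define Z where "Z = X \<inter> (Xhat - X')"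
  have ZE: "Z \<subseteq> E" using XE unfolding Z_def by auto
  have Z1: "sum w Z \<le> \<eta>_plus"
    unfolding eta_plus Z_def using finXhat prediction weights by (intro sum_mono2) auto
  have Z2: "sum w Z \<le> \<alpha> * sum (pair_dist V E w) S"
  proof -
    have "\<forall>e\<in>Z. \<exists>f\<in>M. e \<in> set (path_edges (P f))" unfolding Z_def Xeq by auto
    \<comment> \<open>The charging map. Its image has at most \<open>card Z\<close> elements and
      lies in the tree \<open>M\<close>, which yields the two terms of the minimum in the size of
      \<open>S\<close>.\<close>
    then obtain g where g: "\<forall>e\<in>Z. g e \<in> M \<and> e \<in> set (path_edges (P (g e)))" by metis
    have finZ: "finite Z" using finX unfolding Z_def by auto
    have gM: "g ` Z \<subseteq> M" using g by auto
    have "card (g ` Z) \<le> card Z" using finZ by (rule card_image_le)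
    also have "\<dots> \<le> card (Xhat - X')" unfolding Z_def using finXhat by (intro card_mono) auto
    finally have "card (g ` Z) \<le> card (Xhat - X')" .
    moreover have "card (g ` Z) \<le> k - 1"
      using card_mono[OF finM gM] minimum_spanning_tree_card[OF finT M' c0] terminals by auto
    ultimately have card: "card (g ` Z) \<le> min (k - 1) (card (Xhat - X'))" by simp
    have "sum ?w Z \<le> sum ?w (\<Union>f\<in>g ` Z. set (path_edges (P f)))"
      using g finZ w0 PE by (intro sum_mono2) blast+
    also have "\<dots> \<le> (\<Sum>f\<in>g ` Z. path_cost ?w (P f))"
      using finZ gM PE w0 by (intro sum_path_union_le) blast+
    also have "\<dots> = sum ?c (g ` Z)" using Pc gM by (intro sum.cong) auto
    also have "\<dots> \<le> sum (pair_dist V E w) S"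
      using minimum_spanning_tree_highest_cost[OF finT M' c0 MSTT cle S gM card] .
    finally have "sum ?w Z \<le> sum (pair_dist V E w) S" .
    \<comment> \<open>All edges of \<open>Z\<close> are predicted, so each of their weights was
      divided by \<open>\<alpha>\<close>.\<close>
    moreover have "sum w Z = \<alpha> * sum ?w Z"
      unfolding sum_distrib_left
      using alpha by (intro sum.cong) (auto simp: Z_def scaled_weight_def)
    ultimately show ?thesis using alpha by simp
  qed

  have split: "sum ?w A = sum w (A - Xhat) + sum w (A \<inter> Xhat) / \<alpha>"
    and split': "sum w A = sum w (A - Xhat) + sum w (A \<inter> Xhat)" if "finite A" for A
  proof -
    have *: "sum h A = sum h (A - Xhat) + sum h (A \<inter> Xhat)" for h :: "'a set \<Rightarrow> real"
      using sum.Int_Diff[OF that, of h Xhat] by simp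
    show "sum w A = sum w (A - Xhat) + sum w (A \<inter> Xhat)" by (rule *)
    have "sum ?w (A - Xhat) = sum w (A - Xhat)"
      by (intro sum.cong) (auto simp: scaled_weight_def)
    moreover have "sum ?w (A \<inter> Xhat) = sum w (A \<inter> Xhat) / \<alpha>"
      unfolding sum_divide_distrib by (intro sum.cong) (auto simp: scaled_weight_def)
    ultimately show "sum ?w A = sum w (A - Xhat) + sum w (A \<inter> Xhat) / \<alpha>" using *[of ?w] by simp
  qed
  \<comment> \<open>A predicted edge of \<open>X\<close> either belongs to \<open>X'\<close> or, by
    definition, to \<open>Z\<close>.\<close>
  have "sum w (X \<inter> Xhat) \<le> sum w (X' \<inter> Xhat \<union> Z)"
    using finX' finX X'E ZE weights by (intro sum_mono2) (auto simp: Z_def)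
  also have "\<dots> = sum w (X' \<inter> Xhat) + sum w Z"
    using finX' finX by (intro sum.union_disjoint) (auto simp: Z_def)
  finally have Xhat_le: "sum w (X \<inter> Xhat) \<le> sum w (X' \<inter> Xhat) + sum w Z" .

  define b where "b = 1 / \<alpha>"
  have b: "0 \<le> b" "b \<le> 1" "b * \<alpha> = 1" using alpha unfolding b_def by auto
  have "sum w X = sum ?w X + (1 - b) * sum w (X \<inter> Xhat)"
    using split[OF finX] split'[OF finX] unfolding b_def by (simp add: algebra_simps)
  also have "\<dots> \<le> 2 * sum ?w X' + (1 - b) * (sum w (X' \<inter> Xhat) + sum w Z)"
    using wX Xhat_le b by (intro add_mono mult_left_mono) auto
  \<comment> \<open>Edges of \<open>X'\<close> inside \<open>Xhat\<close> carry the factor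
    \<open>2 * b + (1 - b) = 1 + b\<close>; those outside carry
    \<open>2 = (1 + b) + (1 - b)\<close>, whose second part forms the term with
    \<open>\<eta>_minus\<close>.\<close>
  also have "\<dots> = (1 + b) * sum w X' + (1 - b) * \<eta>_minus + (1 - b) * sum w Z"
    using split[OF finX'] split'[OF finX'] unfolding eta_minus b_def by (simp add: algebra_simps)
  finally have main: "sum w X \<le> (1 + b) * sum w X' + (1 - b) * \<eta>_minus + (1 - b) * sum w Z" .
  have Z0: "0 \<le> sum w Z" using ZE weights by (intro sum_nonneg) auto
  \<comment> \<open>The two bounds on \<open>sum w Z\<close> give the two arguments of the final
    \<open>min\<close>; for the second one,
    \<open>(1 - b) * \<alpha> = \<alpha> - 1\<close>.\<close>
  have "(1 - b) * sum w Z \<le> 1 * sum w Z" using b Z0 by (intro mult_right_mono) auto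
  then have m1: "(1 - b) * sum w Z \<le> \<eta>_plus" using Z1 by simp
  have "(1 - b) * sum w Z \<le> (1 - b) * (\<alpha> * sum (pair_dist V E w) S)"
    using b Z2 by (intro mult_left_mono) auto
  also have "\<dots> = (\<alpha> - b * \<alpha>) * sum (pair_dist V E w) S" by (simp add: algebra_simps)
  finally have m2: "(1 - b) * sum w Z \<le> (\<alpha> - 1) * sum (pair_dist V E w) S" using b by simp
  show ?thesis using st main m1 m2 unfolding b_def by auto
qed

end
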